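(* Two SAP triangles are equisectionally equivalent if and only if they are either similar or reversely similar. Moreover, every triangle is equisectionally equivalent to some SAP triangle.
   Context: Triangles are nondegenerate triangles in the Euclidean plane $\cong\mathbb{C}$. An SAP triangle is a triangle whose side lengths, in some order, are in arithmetic progression (common difference $0$, i.e. a regular triangle, is allowed). Two triangles are called similar if some orientation-preserving similarity of the plane carries one onto the other (labels of vertices need not be matched), and reversely similar if some orientation-reversing similarity of the plane carries one onto the other. Equisection operators: for $q\in\mathbb{R}$ and a triangle $\triangle ABC$ with vertices listed anticlockwise, $T_q(\triangle ABC)=\triangle A'B'C'$ where $A'=qB+(1-q)C$, $B'=qC+(1-q)A$, $C'=qA+(1-q)B$. Equisectional equivalence is the equivalence relation on the set of triangles generated by similarity and $\{T_q\}_{q\in\mathbb{R}}$. *)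

theory Defs
  imports "HOL-Analysis.Analysis"
begin

text \<open>The Euclidean plane is \<open>complex\<close>, and an (unlabelled) triangle is its set of three vertices.\<close>

definition is_triangle :: "complex set \<Rightarrow> bool" where
  "is_triangle T \<longleftrightarrow> (\<exists>A B C. T = {A, B, C} \<and> \<not> collinear {A, B, C})"

definition orientation_preserving_similarity :: "(complex \<Rightarrow> complex) \<Rightarrow> bool" where
  "orientation_preserving_similarity f \<longleftrightarrow> (\<exists>a b. a \<noteq> 0 \<and> f = (\<lambda>z. a * z + b))"

definition orientation_reversing_similarity :: "(complex \<Rightarrow> complex) \<Rightarrow> bool" where
  "orientation_reversing_similarity f \<longleftrightarrow> (\<exists>a b. a \<noteq> 0 \<and> f = (\<lambda>z. a * cnj z + b))"

definition similar :: "complex set \<Rightarrow> complex set \<Rightarrow> bool" where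
  "similar S T \<longleftrightarrow> (\<exists>f. orientation_preserving_similarity f \<and> f ` S = T)"

definition reversely_similar :: "complex set \<Rightarrow> complex set \<Rightarrow> bool" where
  "reversely_similar S T \<longleftrightarrow> (\<exists>f. orientation_reversing_similarity f \<and> f ` S = T)"

text \<open>Relabelling the vertices realises every order of the three side lengths.\<close>

definition SAP_triangle :: "complex set \<Rightarrow> bool" where
  "SAP_triangle T \<longleftrightarrow> is_triangle T \<and> (\<exists>A B C. T = {A, B, C} \<and>
     dist C A - dist B C = dist A B - dist C A)"

text \<open>\<open>Im (cnj (B - A) * (C - A))\<close> is twice the signed area of the triangle \<open>A B C\<close>.\<close>

definition anticlockwise :: "complex \<Rightarrow> complex \<Rightarrow> complex \<Rightarrow> bool" where
  "anticlockwise A B C \<longleftrightarrow> Im (cnj (B - A) * (C - A)) > 0"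

text \<open>The result does not depend on which of the three anticlockwise listings of the vertices is
  used, see \<open>equisection_eq\<close> below.\<close>

definition equisection :: "real \<Rightarrow> complex set \<Rightarrow> complex set" where
  "equisection q T = (THE T'. \<exists>A B C. T = {A, B, C} \<and> anticlockwise A B C \<and>
     T' = {of_real q * B + of_real (1 - q) * C,
           of_real q * C + of_real (1 - q) * A,
           of_real q * A + of_real (1 - q) * B})"

definition equisectionally_equivalent :: "complex set \<Rightarrow> complex set \<Rightarrow> bool" where
  "equisectionally_equivalent S T \<longleftrightarrow> is_triangle S \<and> is_triangle T \<and>
     equivclp (\<lambda>X Y. is_triangle X \<and> is_triangle Y \<and> (similar X Y \<or> (\<exists>q. Y = equisection q X))) S T"

lemma anticlockwise_listing_unique:
  assumes "{A, B, C} = {A', B', C'}" "anticlockwise A B C" "anticlockwise A' B' C'"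
  shows "(A', B', C') \<in> {(A, B, C), (B, C, A), (C, A, B)}"
proof -
  have distinct: "X \<noteq> Y \<and> Y \<noteq> Z \<and> X \<noteq> Z" if "anticlockwise X Y Z" for X Y Z
    using that by (auto simp: anticlockwise_def algebra_simps)
  have "(A', B', C') \<in> {(A, B, C), (B, C, A), (C, A, B), (A, C, B), (C, B, A), (B, A, C)}"
    using assms(1) distinct[OF assms(2)] distinct[OF assms(3)] by (simp add: set_eq_iff) metis
  moreover have "\<not> anticlockwise A C B" "\<not> anticlockwise C B A" "\<not> anticlockwise B A C"
    using assms(2) by (simp_all add: anticlockwise_def algebra_simps)
  ultimately show ?thesis using assms(3) by auto
qed

lemma equisection_eq:
  assumes "anticlockwise A B C"
  shows "equisection q {A, B, C} =
    {of_real q * B + of_real (1 - q) * C,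
     of_real q * C + of_real (1 - q) * A,
     of_real q * A + of_real (1 - q) * B}"
  unfolding equisection_def
proof (rule the_equality, goal_cases)
  case 1
  show ?case using assms by blast
next
  case (2 T')
  then obtain A' B' C' where *: "{A, B, C} = {A', B', C'}" "anticlockwise A' B' C'"
     and T': "T' = {of_real q * B' + of_real (1 - q) * C',
           of_real q * C' + of_real (1 - q) * A',
           of_real q * A' + of_real (1 - q) * B'}" by blast
  from anticlockwise_listing_unique[OF *(1) assms *(2)] show ?case
    unfolding T' by auto
qed

lemma not_collinear_iff_anticlockwise:
  "\<not> collinear {A, B, C} \<longleftrightarrow> anticlockwise A B C \<or> anticlockwise A C B"
proof -
  have "collinear {A, B, C} \<longleftrightarrow> collinear {0, B - A, C - A}"
    using collinear_3[of B A C] by (simp add: insert_commute)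
  also have "\<dots> \<longleftrightarrow> Im (cnj (B - A) * (C - A)) = 0"
    by (auto simp: collinear_iff_Reals complex_is_Real_iff Im_divide algebra_simps
        sum_power2_eq_zero_iff complex_eq_iff)
  finally show ?thesis
    by (auto simp: anticlockwise_def algebra_simps)
qed

lemma anticlockwise_equisection:
  assumes "anticlockwise A B C"
  shows "anticlockwise (of_real q * B + of_real (1 - q) * C)
    (of_real q * C + of_real (1 - q) * A) (of_real q * A + of_real (1 - q) * B)"
proof -
  have "3 * q\<^sup>2 - 3 * q + 1 = 3 * (q - 1/2)\<^sup>2 + 1/4"
    by (simp add: power2_eq_square algebra_simps)
  also have "\<dots> > 0"
    by (simp add: add_nonneg_pos)
  finally have "0 < 3 * q\<^sup>2 - 3 * q + 1" .
  moreover have "Im (cnj ((of_real q * C + of_real (1 - q) * A) - (of_real q * B + of_real (1 - q) * C))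
     * ((of_real q * A + of_real (1 - q) * B) - (of_real q * B + of_real (1 - q) * C)))
     = (3 * q\<^sup>2 - 3 * q + 1) * Im (cnj (B - A) * (C - A))"
    by (simp add: power2_eq_square algebra_simps)
  ultimately show ?thesis
    using assms unfolding anticlockwise_def by simp
qed

lemma triangle_equisection:
  assumes "is_triangle T"
  shows "is_triangle (equisection q T)"
proof -
  obtain A B C where "T = {A, B, C}" "anticlockwise A B C"
    using assms unfolding is_triangle_def not_collinear_iff_anticlockwise
    by (metis insert_commute)
  then show ?thesis
    using anticlockwise_equisection[of A B C q]
    by (auto simp: equisection_eq is_triangle_def not_collinear_iff_anticlockwise)
qed

end

theory Submission imports Defs begin

text \<open>The cotangent of the Brocard angle, \<open>(a\<^sup>2 + b\<^sup>2 + c\<^sup>2) / (4 * area)\<close>, is a complete invariant of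
  equisectional equivalence. In terms of the resolvents
  \<open>u = A + \<omega> * B + \<omega>\<^sup>2 * C\<close> and \<open>v = A + \<omega>\<^sup>2 * B + \<omega> * C\<close> of an anticlockwise triangle, \<open>u / v\<close>
  determines the labelled triangle up to similarity, the invariant amounts to \<open>|u / v|\<close>, and the
  operators \<open>T\<^sub>q\<close> multiply \<open>u / v\<close> by exactly the unit complex numbers other than \<open>-1\<close>.
  For side lengths \<open>y * (1 - s)\<close>, \<open>y\<close>, \<open>y * (1 + s)\<close> the square of the invariant is
  \<open>(3 + 2 * s\<^sup>2)\<^sup>2 / (3 * (1 - 4 * s\<^sup>2))\<close>, which increases strictly with \<open>s\<^sup>2\<close> from \<open>3\<close> to infinity, so it fixes
  the side lengths up to scaling and order, and every value is attained.\<close>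

section \<open>The Brocard cotangent and its invariance\<close>

definition side_square_sum :: "complex \<Rightarrow> complex \<Rightarrow> complex \<Rightarrow> real" where
  "side_square_sum A B C = (dist A B)\<^sup>2 + (dist B C)\<^sup>2 + (dist C A)\<^sup>2"

definition double_area :: "complex \<Rightarrow> complex \<Rightarrow> complex \<Rightarrow> real" where
  "double_area A B C = Im (cnj (B - A) * (C - A))"

text \<open>The absolute value makes the quotient agree on all six listings of the vertices, so the
  value is unique for a triangle.\<close>

definition brocard_cot :: "complex set \<Rightarrow> real" where
  "brocard_cot T = (THE x. \<exists>A B C. T = {A, B, C} \<and>
     x = side_square_sum A B C / (2 * \<bar>double_area A B C\<bar>))"

lemma anticlockwise_iff: "anticlockwise A B C \<longleftrightarrow> double_area A B C > 0"
  by (simp add: anticlockwise_def double_area_def)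

lemma double_area_swap: "double_area A C B = - double_area A B C"
  by (simp add: double_area_def algebra_simps)

lemma double_area_cycle: "double_area B C A = double_area A B C"
  by (simp add: double_area_def algebra_simps)

lemma not_collinear_iff: "\<not> collinear {A, B, C} \<longleftrightarrow> double_area A B C \<noteq> 0"
  using double_area_swap[of A B C]
  by (auto simp: not_collinear_iff_anticlockwise anticlockwise_iff)

lemma is_triangle_iff:
  "is_triangle T \<longleftrightarrow> (\<exists>A B C. T = {A, B, C} \<and> anticlockwise A B C)"
  unfolding is_triangle_def not_collinear_iff_anticlockwise by (metis insert_commute)

lemma dist_sq_Re_Im: "(dist z w)\<^sup>2 = (Re z - Re w)\<^sup>2 + (Im z - Im w)\<^sup>2"
  by (simp add: dist_norm cmod_power2)

lemma brocard_cot_eq: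
  assumes "double_area A B C \<noteq> 0"
  shows "brocard_cot {A, B, C} = side_square_sum A B C / (2 * \<bar>double_area A B C\<bar>)"
  unfolding brocard_cot_def
proof (rule the_equality, goal_cases)
  case 1
  show ?case by blast
next
  case (2 x)
  then obtain A' B' C' where eq: "{A, B, C} = {A', B', C'}"
    and x: "x = side_square_sum A' B' C' / (2 * \<bar>double_area A' B' C'\<bar>)" by blast
  have "A \<noteq> B \<and> B \<noteq> C \<and> A \<noteq> C"
    using assms by (auto simp: double_area_def algebra_simps)
  then have "(A', B', C') \<in> {(A, B, C), (B, C, A), (C, A, B), (A, C, B), (C, B, A), (B, A, C)}"
    using eq by (simp add: set_eq_iff) metis
  moreover have "double_area B C A = double_area A B C" "double_area C A B = double_area A B C"
    "double_area A C B = - double_area A B C" "double_area C B A = - double_area A B C"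
    "double_area B A C = - double_area A B C"
    by (simp_all add: double_area_def algebra_simps)
  ultimately show ?case
    unfolding x by (auto simp: side_square_sum_def dist_commute add_ac)
qed

lemma side_square_sum_affine:
  "side_square_sum (a * A + b) (a * B + b) (a * C + b) = (cmod a)\<^sup>2 * side_square_sum A B C"
proof -
  have "dist (a * z + b) (a * w + b) = cmod a * dist z w" for z w
    by (simp add: dist_norm norm_mult[symmetric] algebra_simps)
  then show ?thesis
    by (simp add: side_square_sum_def power_mult_distrib algebra_simps)
qed

lemma double_area_affine:
  "double_area (a * A + b) (a * B + b) (a * C + b) = (cmod a)\<^sup>2 * double_area A B C"
  unfolding double_area_def cmod_power2
  by (simp add: power2_eq_square algebra_simps)

lemma side_square_sum_cnj: "side_square_sum (cnj A) (cnj B) (cnj C) = side_square_sum A B C"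
  unfolding side_square_sum_def dist_sq_Re_Im by (simp add: power2_eq_square algebra_simps)

lemma double_area_cnj: "double_area (cnj A) (cnj B) (cnj C) = - double_area A B C"
  by (simp add: double_area_def algebra_simps)

lemma brocard_cot_similar:
  assumes "is_triangle S" "similar S T"
  shows "brocard_cot T = brocard_cot S"
proof -
  obtain A B C where S: "S = {A, B, C}" "double_area A B C \<noteq> 0"
    using assms(1) by (auto simp: is_triangle_def not_collinear_iff)
  obtain a b where a: "a \<noteq> 0" and T: "T = {a * A + b, a * B + b, a * C + b}"
    using assms(2) S(1) by (auto simp: similar_def orientation_preserving_similarity_def)
  show ?thesis
    using S(2) a unfolding S(1) T
    by (simp add: brocard_cot_eq side_square_sum_affine double_area_affine abs_mult)
qed

lemma brocard_cot_reversely_similar: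
  assumes "is_triangle S" "reversely_similar S T"
  shows "brocard_cot T = brocard_cot S"
proof -
  obtain A B C where S: "S = {A, B, C}" "double_area A B C \<noteq> 0"
    using assms(1) by (auto simp: is_triangle_def not_collinear_iff)
  obtain a b where a: "a \<noteq> 0" and T: "T = {a * cnj A + b, a * cnj B + b, a * cnj C + b}"
    using assms(2) S(1) by (auto simp: reversely_similar_def orientation_reversing_similarity_def)
  show ?thesis
    using S(2) a unfolding S(1) T
    by (simp add: brocard_cot_eq side_square_sum_affine double_area_affine side_square_sum_cnj
        double_area_cnj abs_mult)
qed

text \<open>The sum of squared sides and the area scale by the same factor, which therefore
  cancels.\<close>

lemma brocard_cot_equisection:
  assumes "is_triangle T"
  shows "brocard_cot (equisection q T) = brocard_cot T"
proof -
  obtain A B C where T: "T = {A, B, C}" and ac: "anticlockwise A B C"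
    using assms by (auto simp: is_triangle_iff)
  let ?A = "of_real q * B + of_real (1 - q) * C"
  let ?B = "of_real q * C + of_real (1 - q) * A"
  let ?C = "of_real q * A + of_real (1 - q) * B"
  let ?c = "3 * q\<^sup>2 - 3 * q + 1"
  have area: "double_area ?A ?B ?C = ?c * double_area A B C"
    unfolding double_area_def by (simp add: power2_eq_square algebra_simps)
  have sides: "side_square_sum ?A ?B ?C = ?c * side_square_sum A B C"
    unfolding side_square_sum_def dist_sq_Re_Im by (simp add: power2_eq_square algebra_simps)
  have pos: "double_area ?A ?B ?C > 0" "double_area A B C > 0"
    using ac anticlockwise_equisection[OF ac, of q] by (auto simp: anticlockwise_iff)
  \<comment> \<open>The factor is the quotient of two positive areas.\<close>
  then have "?c > 0"
    unfolding area by (simp add: zero_less_mult_iff)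
  then show ?thesis
    using pos unfolding T equisection_eq[OF ac]
    by (simp add: brocard_cot_eq sides area del: of_real_diff)
qed

lemma brocard_cot_equisectionally_equivalent:
  assumes "equisectionally_equivalent S T"
  shows "brocard_cot S = brocard_cot T"
proof -
  have "equivclp (\<lambda>X Y. is_triangle X \<and> is_triangle Y \<and>
      (similar X Y \<or> (\<exists>q. Y = equisection q X))) S T"
    using assms by (simp add: equisectionally_equivalent_def)
  then show ?thesis
    by (induction rule: equivclp_induct)
      (auto simp: brocard_cot_similar brocard_cot_equisection)
qed

section \<open>Resolvents of a labelled triangle\<close>

definition \<omega> :: complex where
  "\<omega> = Complex (- 1 / 2) (sqrt 3 / 2)"

lemma Re_omega [simp]: "Re \<omega> = - 1 / 2" and Im_omega [simp]: "Im \<omega> = sqrt 3 / 2"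
  by (simp_all add: \<omega>_def)

lemma cnj_omega: "cnj \<omega> = - 1 - \<omega>"
  by (simp add: complex_eq_iff)

lemma omega_square: "\<omega> * \<omega> = - 1 - \<omega>"
  by (simp add: complex_eq_iff)

lemma omega_square_mult: "\<omega> * (\<omega> * z) = - z - \<omega> * z"
  unfolding mult.assoc[symmetric] omega_square by (simp add: algebra_simps)

text \<open>A discrete Fourier coefficient of the labelled triangle. It gives \<open>u\<close> as
  \<open>resolvent A B C\<close> and \<open>v\<close> as \<open>resolvent A C B\<close>.\<close>

definition resolvent :: "complex \<Rightarrow> complex \<Rightarrow> complex \<Rightarrow> complex" where
  "resolvent A B C = A + \<omega> * B + cnj \<omega> * C"

text \<open>Consequently a cyclic relabelling multiplies \<open>u / v\<close> by
  \<open>cnj \<omega> / \<omega> = \<omega>\<close>, which later helps to avoid the factor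
  \<open>-1\<close>.\<close>

lemma resolvent_cycle: "resolvent B C A = cnj \<omega> * resolvent A B C"
  and resolvent_swap_cycle: "resolvent B A C = \<omega> * resolvent A C B"
  unfolding resolvent_def cnj_omega
  by (simp_all add: algebra_simps omega_square omega_square_mult)

text \<open>An equisection combines two cyclic shifts of the vertices linearly, so it acts
  diagonally on Fourier coefficients. For real \<open>q\<close> the multiplier of \<open>v\<close>
  is the conjugate of this one, whence \<open>u / v\<close> only rotates.\<close>

lemma resolvent_equisection:
  "resolvent (q * B + (1 - q) * C) (q * C + (1 - q) * A) (q * A + (1 - q) * B) =
     (q * cnj \<omega> + (1 - q) * \<omega>) * resolvent A B C"
  unfolding resolvent_def cnj_omega
  by (simp add: algebra_simps omega_square omega_square_mult)

lemma resolvent_equisection_swap: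
  "resolvent (q * B + (1 - q) * C) (q * A + (1 - q) * B) (q * C + (1 - q) * A) =
     (q * \<omega> + (1 - q) * cnj \<omega>) * resolvent A C B"
  unfolding resolvent_def cnj_omega
  by (simp add: algebra_simps omega_square omega_square_mult)

text \<open>Swapping two vertices flips the sign of the area term. For an anticlockwise triangle
  with Brocard cotangent \<open>k\<close> this gives
  \<open>|u / v|\<^sup>2 = (k - sqrt 3) / (k + sqrt 3)\<close>.\<close>

lemma norm_resolvent_sq:
  "(cmod (resolvent A B C))\<^sup>2 = side_square_sum A B C / 2 - sqrt 3 * double_area A B C"
proof -
  define r where "r = sqrt 3"
  have r: "r * r = 3" "r * (r * z) = 3 * z" for z
    by (simp_all add: r_def flip: mult.assoc)
  have "2 * Re (resolvent A B C) = 2 * Re A - Re B - Re C - r * (Im B - Im C)"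
    "2 * Im (resolvent A B C) = 2 * Im A - Im B - Im C + r * (Re B - Re C)"
    by (simp_all add: resolvent_def r_def field_simps)
  then have "4 * (cmod (resolvent A B C))\<^sup>2 =
      (2 * Re A - Re B - Re C - r * (Im B - Im C))\<^sup>2 + (2 * Im A - Im B - Im C + r * (Re B - Re C))\<^sup>2"
    unfolding cmod_power2 by algebra
  also have "\<dots> = 2 * side_square_sum A B C - 4 * r * double_area A B C"
    unfolding side_square_sum_def double_area_def dist_sq_Re_Im
    by (simp add: power2_eq_square algebra_simps r)
  finally show ?thesis
    by (simp add: r_def)
qed

lemma side_square_sum_swap: "side_square_sum A C B = side_square_sum A B C"
  by (simp add: side_square_sum_def dist_commute)

lemma side_square_sum_nonneg: "side_square_sum A B C \<ge> 0"
  by (simp add: side_square_sum_def)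

text \<open>For \<open>v\<close> the area term is added. In contrast \<open>u\<close> vanishes for
  regular triangles, so later divisions must be arranged around \<open>v\<close>.\<close>

lemma resolvent_swap_nonzero:
  assumes "anticlockwise A B C"
  shows "resolvent A C B \<noteq> 0"
proof -
  have "(cmod (resolvent A C B))\<^sup>2 > 0"
    unfolding norm_resolvent_sq double_area_swap[of A C B]
    using assms side_square_sum_nonneg[of A C B] by (simp add: anticlockwise_iff add_nonneg_pos)
  then show ?thesis by auto
qed

text \<open>Fourier inversion recovers the vertices from \<open>u\<close>, \<open>v\<close> and the
  vertex sum. The factor \<open>a\<close> fixes rotation and scale, and the translation
  \<open>b\<close> matches the centroids.\<close>

lemma similar_if_resolvent_proportional:
  assumes "resolvent A' B' C' = a * resolvent A B C" "resolvent A' C' B' = a * resolvent A C B"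
    and "a \<noteq> 0"
  shows "similar {A, B, C} {A', B', C'}"
proof -
  define b where "b = ((A' + B' + C') - a * (A + B + C)) / 3"
  have inv: "3 * A = (A + B + C) + resolvent A B C + resolvent A C B"
    "3 * B = (A + B + C) + cnj \<omega> * resolvent A B C + \<omega> * resolvent A C B"
    "3 * C = (A + B + C) + \<omega> * resolvent A B C + cnj \<omega> * resolvent A C B" for A B C
    unfolding resolvent_def cnj_omega by (simp_all add: algebra_simps omega_square omega_square_mult)
  have b: "3 * b = (A' + B' + C') - a * (A + B + C)"
    by (simp add: b_def)
  have "3 * A' = a * (3 * A) + 3 * b"
    unfolding b inv(1)[of A B C] inv(1)[of A' B' C'] assms by (simp add: algebra_simps)
  moreover have "3 * B' = a * (3 * B) + 3 * b"
    unfolding b inv(2)[of B A C] inv(2)[of B' A' C'] assms by (simp add: algebra_simps)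
  moreover have "3 * C' = a * (3 * C) + 3 * b"
    unfolding b inv(3)[of C A B] inv(3)[of C' A' B'] assms by (simp add: algebra_simps)
  ultimately have "A' = a * A + b" "B' = a * B + b" "C' = a * C + b"
    by algebra+
  then show ?thesis
    using assms(3) unfolding similar_def orientation_preserving_similarity_def
    by (intro exI[of _ "\<lambda>z. a * z + b"]) auto
qed

section \<open>Completeness of the invariant\<close>

text \<open>The hypothesis \<open>eq\<close> is \<open>u' / v' = e * (u / v)\<close> without
  denominators. The multiplier \<open>w\<close> of \<open>u\<close> runs through the line
  \<open>Re w = -1/2\<close>, and \<open>w / cnj w = e\<close> is solved there by the real multiple
  of \<open>1 + e\<close> on that line, which exists unless \<open>e = -1\<close>.\<close>

lemma similar_equisection_if_rotated:
  assumes ac: "anticlockwise A B C" "anticlockwise A' B' C'"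
    and eq: "resolvent A' B' C' * resolvent A C B = e * (resolvent A B C * resolvent A' C' B')"
    and e: "cmod e = 1" "e \<noteq> - 1"
  shows "\<exists>q. similar (equisection q {A, B, C}) {A', B', C'}"
proof -
  have e1: "e * cnj e = 1"
    using e(1) using complex_norm_square[of e] by simp
  have "Re e \<noteq> - 1"
  proof
    assume "Re e = - 1"
    moreover from this have "Im e = 0"
      using e(1) cmod_power2[of e] by simp
    ultimately show False
      using e(2) by (simp add: complex_eq_iff)
  qed
  then have pos: "1 + Re e \<noteq> 0" by auto
  \<comment> \<open>\<open>h\<close> is the tangent of half the argument of \<open>e\<close>, and
    \<open>q\<close> is chosen to give \<open>Im w = - h / 2\<close>.\<close>
  define h where "h = Im e / (1 + Re e)"
  define q where "q = (1 + h / sqrt 3) / 2"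
  define w where "w = q * cnj \<omega> + (1 - q) * \<omega>"
  have cw: "cnj w = q * \<omega> + (1 - q) * cnj \<omega>"
    by (simp add: w_def)
  have w: "w * of_real (2 * (1 + Re e)) = - (1 + e)"
  proof -
    have "(1 - 2 * q) * sqrt 3 = - h"
      by (simp add: q_def algebra_simps)
    then have "w = Complex (- 1 / 2) (- h / 2)"
      unfolding w_def by (simp add: complex_eq_iff algebra_simps)
    then show ?thesis
      using pos by (simp add: h_def complex_eq_iff field_simps)
  qed
  \<comment> \<open>After conjugation, multiplying by \<open>e\<close> turns
    \<open>1 + cnj e\<close> back into \<open>1 + e\<close>, because
    \<open>e * cnj e = 1\<close>.\<close>
  have "cnj w * of_real (2 * (1 + Re e)) = - (1 + cnj e)"
    using arg_cong[OF w, of cnj] by simp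
  then have "e * cnj w * of_real (2 * (1 + Re e)) = - (e + e * cnj e)"
    unfolding mult.assoc by (simp only: distrib_left mult_1_right mult_minus_right)
  also have "\<dots> = w * of_real (2 * (1 + Re e))"
    unfolding w e1 by simp
  finally have ew: "e * cnj w = w"
    using pos by (metis mult_right_cancel of_real_eq_0_iff mult_eq_0_iff zero_neq_numeral)
  have "Re w = - 1 / 2"
    by (simp add: w_def field_simps)
  then have w0: "cnj w \<noteq> 0"
    by auto
  \<comment> \<open>The scale is read off from \<open>v\<close> alone, since \<open>u\<close> may be
    zero.\<close>
  define a where "a = resolvent A' C' B' / (cnj w * resolvent A C B)"
  note nz = resolvent_swap_nonzero[OF ac(1)] resolvent_swap_nonzero[OF ac(2)]
  have "resolvent A' C' B' = a * (cnj w * resolvent A C B)"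
    using nz w0 by (simp add: a_def)
  moreover have "resolvent A' B' C' = a * (w * resolvent A B C)"
  proof -
    have "a * (w * resolvent A B C) * resolvent A C B =
        a * (e * cnj w * resolvent A B C) * resolvent A C B"
      by (simp only: ew)
    also have "\<dots> = e * (resolvent A B C * resolvent A' C' B')"
      using nz w0 by (simp add: a_def del: complex_cnj_zero_iff)
    finally show ?thesis
      using nz(1) unfolding eq[symmetric] by simp
  qed
  moreover have "a \<noteq> 0"
    using nz w0 by (simp add: a_def)
  ultimately have "similar (equisection q {A, B, C}) {A', B', C'}"
    unfolding equisection_eq[OF ac(1)]
    by (intro similar_if_resolvent_proportional[of _ _ _ a])
      (simp_all add: resolvent_equisection resolvent_equisection_swap w_def)
  then show ?thesis ..
qed

text \<open>Equal cotangents give equal \<open>|u / v|\<close>, so the two ratios differ by a unit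
  factor \<open>e\<close>. A single equisection followed by a similarity then carries
  \<open>S\<close> to \<open>T\<close>.\<close>

lemma equisectionally_equivalent_if_brocard_cot_eq:
  assumes tri: "is_triangle S" "is_triangle T" and cot: "brocard_cot S = brocard_cot T"
  shows "equisectionally_equivalent S T"
proof -
  obtain A B C where S: "S = {A, B, C}" and ac: "anticlockwise A B C"
    using tri(1) by (auto simp: is_triangle_iff)
  obtain A' B' C' where T: "T = {A', B', C'}" and ac': "anticlockwise A' B' C'"
    using tri(2) by (auto simp: is_triangle_iff)
  have "side_square_sum A B C * double_area A' B' C' = side_square_sum A' B' C' * double_area A B C"
    using cot ac ac' unfolding S T anticlockwise_iff by (simp add: brocard_cot_eq field_simps)
  then have "(cmod (resolvent A' B' C'))\<^sup>2 * (cmod (resolvent A C B))\<^sup>2 =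
      (cmod (resolvent A B C))\<^sup>2 * (cmod (resolvent A' C' B'))\<^sup>2"
    unfolding norm_resolvent_sq double_area_swap[of A C B] double_area_swap[of A' C' B']
      side_square_sum_swap[of A C B] side_square_sum_swap[of A' C' B']
    by (simp add: algebra_simps)
  then have norm_eq: "cmod (resolvent A' B' C' * resolvent A C B) =
      cmod (resolvent A B C * resolvent A' C' B')"
    by (simp add: norm_mult flip: power_mult_distrib)
  \<comment> \<open>If \<open>u = 0\<close>, the equality of norms forces \<open>u' = 0\<close> as
    well, and any unit factor would do; \<open>1\<close> stays clear of the exceptional
    \<open>-1\<close>.\<close>
  define e where "e = (if resolvent A B C = 0 then 1 else
      resolvent A' B' C' * resolvent A C B / (resolvent A B C * resolvent A' C' B'))"
  note nz = resolvent_swap_nonzero[OF ac] resolvent_swap_nonzero[OF ac']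
  have e: "resolvent A' B' C' * resolvent A C B = e * (resolvent A B C * resolvent A' C' B')"
    using nz norm_eq by (auto simp: e_def)
  have norm_e: "cmod e = 1"
    using nz norm_eq by (auto simp: e_def norm_divide)
  have "\<exists>q. similar (equisection q S) T"
  proof (cases "e = - 1")
    case False
    then show ?thesis
      unfolding S T using similar_equisection_if_rotated[OF ac ac' e norm_e] by blast
  next
    case True
    \<comment> \<open>No equisection rotates \<open>u / v\<close> by \<open>-1\<close>, but a cyclic relabelling of \<open>S\<close> turns the required factor into \<open>1 + \<omega>\<close>.\<close>
    have ac2: "anticlockwise B C A"
      using ac by (simp add: anticlockwise_iff double_area_cycle)
    have "(1 + \<omega>) * cnj \<omega> = - \<omega>"
      unfolding cnj_omega by (simp add: algebra_simps omega_square)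
    then have "resolvent A' B' C' * resolvent B A C =
        (1 + \<omega>) * (resolvent B C A * resolvent A' C' B')"
      unfolding resolvent_cycle[of B C A] resolvent_swap_cycle[of B A C] using e[unfolded True] by algebra
    moreover have "cmod (1 + \<omega>) = 1"
      by (simp add: cmod_def power2_eq_square)
    moreover have "1 + \<omega> \<noteq> - 1"
      by (simp add: complex_eq_iff)
    ultimately have "\<exists>q. similar (equisection q {B, C, A}) {A', B', C'}"
      by (rule similar_equisection_if_rotated[OF ac2 ac'])
    then show ?thesis
      unfolding S T by (simp add: insert_commute)
  qed
  then obtain q where q: "similar (equisection q S) T" ..
  let ?R = "\<lambda>X Y. is_triangle X \<and> is_triangle Y \<and> (similar X Y \<or> (\<exists>q. Y = equisection q X))"
  have "equivclp ?R S (equisection q S)" "equivclp ?R (equisection q S) T"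
    using tri q triangle_equisection[OF tri(1), of q] by (intro r_into_equivclp; blast)+
  then have "equivclp ?R S T"
    by (rule equivclp_trans)
  then show ?thesis
    using tri by (simp add: equisectionally_equivalent_def)
qed

theorem equisectionally_equivalent_iff_brocard_cot_eq:
  assumes "is_triangle S" "is_triangle T"
  shows "equisectionally_equivalent S T \<longleftrightarrow> brocard_cot S = brocard_cot T"
  using assms equisectionally_equivalent_if_brocard_cot_eq brocard_cot_equisectionally_equivalent
  by blast

section \<open>SAP triangles are determined by the invariant\<close>

text \<open>Move \<open>A\<close> to \<open>0\<close> and \<open>B\<close> to \<open>1\<close>. The
  distances of the third vertex \<open>w\<close> from these two points determine it up to
  conjugation, and the two choices give the two kinds of similarity.\<close>

lemma similar_or_reversely_similar_if_sides_proportional: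
  assumes "A \<noteq> B" "k > 0"
    and d: "dist A' B' = k * dist A B" "dist B' C' = k * dist B C" "dist C' A' = k * dist C A"
  shows "similar {A, B, C} {A', B', C'} \<or> reversely_similar {A, B, C} {A', B', C'}"
proof -
  have ne: "B - A \<noteq> 0" "B' - A' \<noteq> 0"
    using assms by auto
  define w w' where "w = (C - A) / (B - A)" and "w' = (C' - A') / (B' - A')"
  have w: "C = A + w * (B - A)" and w': "C' = A' + w' * (B' - A')"
    using ne by (simp_all add: w_def w'_def)
  have norms: "cmod w = dist C A / dist A B" "cmod w' = dist C' A' / dist A' B'"
    "cmod (w - 1) = dist B C / dist A B" "cmod (w' - 1) = dist B' C' / dist A' B'"
    using ne by (simp_all add: w_def w'_def dist_norm norm_divide divide_diff_eq_iff norm_minus_commute)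
  then have "cmod w = cmod w'" "cmod (w - 1) = cmod (w' - 1)"
    using \<open>k > 0\<close> by (simp_all add: d)
  then have "(cmod w)\<^sup>2 = (cmod w')\<^sup>2" "(cmod (w - 1))\<^sup>2 = (cmod (w' - 1))\<^sup>2"
    by simp_all
  then have "Re w = Re w'" "(Im w)\<^sup>2 = (Im w')\<^sup>2"
    unfolding cmod_power2 by (simp_all add: power2_eq_square algebra_simps)
  then have "w' = w \<or> w' = cnj w"
    by (auto simp: complex_eq_iff power2_eq_iff)
  then show ?thesis
  proof
    assume "w' = w"
    define a where "a = (B' - A') / (B - A)"
    have "a * (B - A) = B' - A'" "a \<noteq> 0"
      using ne by (simp_all add: a_def)
    then have "a * A + (A' - a * A) = A'" "a * B + (A' - a * A) = B'" "a * C + (A' - a * A) = C'"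
      unfolding w w' \<open>w' = w\<close> by (simp, algebra, algebra)
    then have "similar {A, B, C} {A', B', C'}"
      using \<open>a \<noteq> 0\<close> unfolding similar_def orientation_preserving_similarity_def
      by (intro exI[of _ "\<lambda>z. a * z + (A' - a * A)"]) auto
    then show ?thesis ..
  next
    assume "w' = cnj w"
    define a where "a = (B' - A') / cnj (B - A)"
    have "a * cnj (B - A) = B' - A'" "a \<noteq> 0"
      using ne by (simp_all add: a_def del: complex_cnj_diff)
    then have "a * cnj A + (A' - a * cnj A) = A'" "a * cnj B + (A' - a * cnj A) = B'"
      "a * cnj C + (A' - a * cnj A) = C'"
      unfolding w w' \<open>w' = cnj w\<close> complex_cnj_add complex_cnj_mult complex_cnj_diff
      by (simp, algebra, algebra)
    then have "reversely_similar {A, B, C} {A', B', C'}"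
      using \<open>a \<noteq> 0\<close> unfolding reversely_similar_def orientation_reversing_similarity_def
      by (intro exI[of _ "\<lambda>z. a * cnj z + (A' - a * cnj A)"]) auto
    then show ?thesis ..
  qed
qed

lemma heron:
  "4 * (double_area A B C)\<^sup>2 = 2 * ((dist B C)\<^sup>2 * (dist C A)\<^sup>2 + (dist C A)\<^sup>2 * (dist A B)\<^sup>2
     + (dist A B)\<^sup>2 * (dist B C)\<^sup>2) - (dist B C)^4 - (dist C A)^4 - (dist A B)^4"
proof -
  \<comment> \<open>Only squared distances remain, so the claim becomes a polynomial identity in the
    coordinates.\<close>
  have fourth: "x ^ 4 = (x\<^sup>2)\<^sup>2" for x :: real
    by simp
  have area: "double_area A B C =
      (Re B - Re A) * (Im C - Im A) - (Im B - Im A) * (Re C - Re A)"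
    by (simp add: double_area_def algebra_simps)
  show ?thesis
    unfolding fourth dist_sq_Re_Im area by algebra
qed

text \<open>The scale is the middle term \<open>y\<close> and the shape is the relative common
  difference \<open>s\<close>, whose sign depends on the listing. By Heron's formula the area is
  nonzero only if \<open>4 * s\<^sup>2 < 1\<close>; squaring the cotangent avoids the root in the
  area.\<close>

lemma SAP_triangleE:
  assumes "SAP_triangle T"
  obtains A B C y s where "T = {A, B, C}" "y > 0" "4 * s\<^sup>2 < 1"
    "dist B C = y * (1 - s)" "dist C A = y" "dist A B = y * (1 + s)"
    "(brocard_cot T)\<^sup>2 = (3 + 2 * s\<^sup>2)\<^sup>2 / (3 * (1 - 4 * s\<^sup>2))"
proof -
  obtain A B C where T: "T = {A, B, C}" and ap: "dist C A - dist B C = dist A B - dist C A"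
    using assms by (auto simp: SAP_triangle_def)
  have D: "double_area A B C \<noteq> 0"
    using assms unfolding SAP_triangle_def T is_triangle_def by (metis not_collinear_iff)
  then have "A \<noteq> C"
    by (auto simp: double_area_def)
  define y s where "y = dist C A" and "s = (dist A B - dist C A) / dist C A"
  have y: "y > 0"
    using \<open>A \<noteq> C\<close> by (simp add: y_def)
  have sides: "dist B C = y * (1 - s)" "dist C A = y" "dist A B = y * (1 + s)"
    using ap y by (simp_all add: y_def s_def field_simps)
  have area: "4 * (double_area A B C)\<^sup>2 = y^4 * (3 * (1 - 4 * s\<^sup>2))"
    unfolding heron sides by algebra
  have "0 < 4 * (double_area A B C)\<^sup>2"
    using D by simp
  then have s: "4 * s\<^sup>2 < 1"
    using y unfolding area by (simp add: zero_less_mult_iff)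
  have "side_square_sum A B C = y\<^sup>2 * (3 + 2 * s\<^sup>2)"
    unfolding side_square_sum_def sides by algebra
  then have "(brocard_cot T)\<^sup>2 = (y\<^sup>2 * (3 + 2 * s\<^sup>2))\<^sup>2 / (4 * (double_area A B C)\<^sup>2)"
    using D unfolding T by (simp add: brocard_cot_eq power_divide power_mult_distrib)
  also have "\<dots> = (y^4 * (3 + 2 * s\<^sup>2)\<^sup>2) / (y^4 * (3 * (1 - 4 * s\<^sup>2)))"
    unfolding area by (simp add: power_mult_distrib)
  also have "\<dots> = (3 + 2 * s\<^sup>2)\<^sup>2 / (3 * (1 - 4 * s\<^sup>2))"
    using y by simp
  finally show ?thesis
    using that T y s sides by blast
qed

text \<open>Here \<open>t\<close> and \<open>u\<close> stand for values of \<open>s\<^sup>2\<close>: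
  the numerator grows while the positive denominator shrinks.\<close>

lemma SAP_cot_strict_mono:
  fixes t u :: real
  assumes "0 \<le> t" "t < u" "4 * u < 1"
  shows "(3 + 2 * t)\<^sup>2 / (3 * (1 - 4 * t)) < (3 + 2 * u)\<^sup>2 / (3 * (1 - 4 * u))"
  using assms by (intro frac_less power_strict_mono) auto

lemma SAP_similar_if_brocard_cot_eq:
  assumes "SAP_triangle S" "SAP_triangle T" and cot: "brocard_cot S = brocard_cot T"
  shows "similar S T \<or> reversely_similar S T"
proof -
  obtain A B C y s where S: "S = {A, B, C}" "y > 0" "4 * s\<^sup>2 < 1"
    "dist B C = y * (1 - s)" "dist C A = y" "dist A B = y * (1 + s)"
    "(brocard_cot S)\<^sup>2 = (3 + 2 * s\<^sup>2)\<^sup>2 / (3 * (1 - 4 * s\<^sup>2))"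
    using SAP_triangleE[OF assms(1)] .
  obtain A' B' C' y' s' where T: "T = {A', B', C'}" "y' > 0" "4 * s'\<^sup>2 < 1"
    "dist B' C' = y' * (1 - s')" "dist C' A' = y'" "dist A' B' = y' * (1 + s')"
    "(brocard_cot T)\<^sup>2 = (3 + 2 * s'\<^sup>2)\<^sup>2 / (3 * (1 - 4 * s'\<^sup>2))"
    using SAP_triangleE[OF assms(2)] .
  have "s'\<^sup>2 = s\<^sup>2"
    using SAP_cot_strict_mono[of "s\<^sup>2" "s'\<^sup>2"] SAP_cot_strict_mono[of "s'\<^sup>2" "s\<^sup>2"]
      S(3,7) T(3,7) cot by (cases "s\<^sup>2" "s'\<^sup>2" rule: linorder_cases) auto
  then have s': "s' = s \<or> s' = - s"
    by (simp add: power2_eq_iff)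
  have "1 + s \<noteq> 0"
    using S(3) by (auto simp: add_eq_0_iff2)
  then have "A \<noteq> B"
    using S(2,6) by auto
  have k: "y' / y > 0"
    using S(2) T(2) by simp
  from s' show ?thesis
  proof
    assume "s' = s"
    then show ?thesis
      unfolding S(1) T(1) using S(2,4-6) T(4-6)
      by (intro similar_or_reversely_similar_if_sides_proportional[OF \<open>A \<noteq> B\<close> k]) simp_all
  next
    \<comment> \<open>The sign change exchanges the two outer terms of the progression; listing the
      second triangle backwards undoes it.\<close>
    assume "s' = - s"
    then have "similar {A, B, C} {C', B', A'} \<or> reversely_similar {A, B, C} {C', B', A'}"
      using S(2,4-6) T(4-6)
      by (intro similar_or_reversely_similar_if_sides_proportional[OF \<open>A \<noteq> B\<close> k])
        (simp_all add: dist_commute)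
    then show ?thesis
      unfolding S(1) T(1) by (simp add: insert_commute)
  qed
qed

section \<open>SAP triangles attain every value\<close>

text \<open>Weitzenboeck's inequality, obtained from \<open>|u|\<^sup>2 >= 0\<close>.\<close>

lemma brocard_cot_ge:
  assumes "is_triangle T"
  shows "brocard_cot T \<ge> sqrt 3"
proof -
  obtain A B C where T: "T = {A, B, C}" and ac: "double_area A B C > 0"
    using assms by (auto simp: is_triangle_iff anticlockwise_iff)
  have "0 \<le> (cmod (resolvent A B C))\<^sup>2"
    by simp
  then show ?thesis
    using ac unfolding T norm_resolvent_sq by (simp add: brocard_cot_eq field_simps)
qed

lemma SAP_triangle_with_brocard_cot:
  assumes "k \<ge> sqrt 3"
  shows "\<exists>T. SAP_triangle T \<and> brocard_cot T = k"
proof -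
  \<comment> \<open>A zero of \<open>f\<close> is a relative difference with cotangent
    \<open>k\<close>. With denominators cleared, \<open>f\<close> is continuous up to the degenerate
    value \<open>s = 1 / 2\<close>, where it equals \<open>7 / 2\<close>.\<close>
  define f where "f s = 3 + 2 * s\<^sup>2 - k * (sqrt 3 * sqrt (1 - 4 * s\<^sup>2))" for s
  have "f 0 \<le> 0"
    using mult_right_mono[OF assms, of "sqrt 3"] by (simp add: f_def)
  moreover have "f (1 / 2) \<ge> 0"
    by (simp add: f_def power2_eq_square)
  moreover have "continuous_on {0..1 / 2} f"
    unfolding f_def by (intro continuous_intros)
  ultimately obtain s where s: "0 \<le> s" "s \<le> 1 / 2" "f s = 0"
    using IVT'[of f 0 0 "1 / 2"] by auto
  have "s \<noteq> 1 / 2"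
  proof
    assume "s = 1 / 2"
    then have "4 * s\<^sup>2 = 1"
      by (simp only:) (simp add: power_divide)
    then show False
      using s(3) by (simp add: f_def)
  qed
  then have s2: "4 * s\<^sup>2 < 1"
    using s power_strict_mono[of s "1 / 2" 2] by (simp add: power_divide)
  \<comment> \<open>The height over the base from \<open>0\<close> to \<open>1\<close>, as given by
    Heron's formula for sides \<open>1 - s\<close>, \<open>1\<close>, \<open>1 + s\<close>.\<close>
  define h where "h = sqrt 3 / 2 * sqrt (1 - 4 * s\<^sup>2)"
  have h: "h > 0" "h\<^sup>2 = 3 / 4 * (1 - 4 * s\<^sup>2)"
    using s2 by (simp_all add: h_def power_mult_distrib power_divide)
  \<comment> \<open>The real part comes from subtracting the equations for distance
    \<open>1 - s\<close> from \<open>0\<close> and \<open>1 + s\<close> from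
    \<open>1\<close>.\<close>
  define B where "B = Complex (1 / 2 - 2 * s) h"
  have "(dist B 0)\<^sup>2 = (1 - s)\<^sup>2" "(dist 1 B)\<^sup>2 = (1 + s)\<^sup>2"
    unfolding dist_sq_Re_Im B_def by (simp_all add: h(2)) (simp_all add: power2_eq_square field_simps)
  then have sides: "dist B 0 = 1 - s" "dist 1 B = 1 + s"
    using s by (simp_all add: power2_eq_iff_nonneg)
  have area: "double_area 1 B 0 = h"
    by (simp add: double_area_def B_def)
  have "\<not> collinear {1, B, 0}"
    using area h(1) by (simp add: not_collinear_iff)
  moreover have "dist 0 (1 :: complex) - dist B 0 = dist 1 B - dist 0 (1 :: complex)"
    unfolding sides by (simp add: dist_norm)
  ultimately have "SAP_triangle {1, B, 0}"
    unfolding SAP_triangle_def is_triangle_def by blast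
  moreover have "brocard_cot {1, B, 0} = k"
  proof -
    have "side_square_sum 1 B 0 = 3 + 2 * s\<^sup>2"
      unfolding side_square_sum_def sides by (simp add: power2_eq_square algebra_simps)
    also have "\<dots> = k * (2 * h)"
      using s(3) by (simp add: f_def h_def)
    finally show ?thesis
      using area h(1) by (simp add: brocard_cot_eq)
  qed
  ultimately show ?thesis
    by blast
qed

theorem corollary4:
  "(\<forall>S T. SAP_triangle S \<longrightarrow> SAP_triangle T \<longrightarrow>
      (equisectionally_equivalent S T \<longleftrightarrow> similar S T \<or> reversely_similar S T)) \<and>
   (\<forall>T. is_triangle T \<longrightarrow> (\<exists>S. SAP_triangle S \<and> equisectionally_equivalent T S))"
proof (intro conjI allI impI)
  fix S T
  assume SAP: "SAP_triangle S" "SAP_triangle T"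
  then have tri: "is_triangle S" "is_triangle T"
    by (simp_all add: SAP_triangle_def)
  show "equisectionally_equivalent S T \<longleftrightarrow> similar S T \<or> reversely_similar S T"
    unfolding equisectionally_equivalent_iff_brocard_cot_eq[OF tri]
    using SAP_similar_if_brocard_cot_eq[OF SAP] brocard_cot_similar[OF tri(1)]
      brocard_cot_reversely_similar[OF tri(1)] by metis
next
  fix T
  assume T: "is_triangle T"
  then obtain S where "SAP_triangle S" "brocard_cot S = brocard_cot T"
    using SAP_triangle_with_brocard_cot[OF brocard_cot_ge[OF T]] by blast
  then show "\<exists>S. SAP_triangle S \<and> equisectionally_equivalent T S"
    using T equisectionally_equivalent_if_brocard_cot_eq SAP_triangle_def by metis
qed

end
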